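(* For each integer $q>1$ let $K = 2^q-1$, $u_k = k2^{-q}$ for $k\in\{0,1,\ldots,2^q\}$, and $I_k = (u_k,u_{k+1})$ for $k\in\{0,1,\ldots,K\}$. For each integer $q>1$ let $Q=Q^{(q)}$ be a function on $(0,1)$ which is piecewise constant on these $2^q$ equally spaced intervals, i.e. there are real constants $Q_k = Q^{(q)}_k$ with $Q(u) = Q_k$ for all $u\in I_k$, $k\in\{0,1,\ldots,K\}$. Assume there exists a constant $C$, independent of $q$, such that for every $q$: \begin{enumerate} \item $Q_k = -Q_{K-k}$ for all $k\in\{0,1,2,\ldots,K\}$; \item $\Phi^{-1}(u_k)\le Q_k\le \Phi^{-1}(u_{k+1})$ for all $k\in\{1,2,\ldots,K-1\}$; \item $\Phi^{-1}(u_K)\le Q_K\le \Phi^{-1}(u_K)+Cq^{-1/2}$. \end{enumerate} Then for any even integer $p\ge 2$, $$\lVert Q-\Phi^{-1}\rVert_p^p = O(2^{-q}q^{-p/2})\quad\text{as } q\to\infty .$$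
   Context: $\Phi$ denotes the cumulative distribution function of the standard Gaussian distribution $N(0,1)$ and $\Phi^{-1}\colon(0,1)\to\mathbb{R}$ its inverse. For a measurable function $f$ on $(0,1)$, $\lVert f\rVert_p = \left(\int_0^1|f(u)|^p\,du\right)^{1/p}$. The values of $Q$ at the finitely many interval endpoints are irrelevant. The implied constant in the $O$-notation does not depend on $q$. *)

theory Defs
  imports "HOL-Probability.Probability" "HOL-Library.Landau_Symbols"
begin

definition Phi :: "real \<Rightarrow> real" where
  "Phi x = cdf std_normal_distribution x"

text \<open>
  \<^const>\<open>Phi\<close> is a bijection from the reals onto the open unit interval, so \<open>Phi_inv u\<close> is
  meaningful only for \<open>0 < u < 1\<close>; outside that interval its value is unspecified.
\<close>
definition Phi_inv :: "real \<Rightarrow> real" where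
  "Phi_inv = inv Phi"

text \<open>
  If \<open>\<bar>f\<bar>\<^sup>p\<close> is not integrable over the unit interval, the Bochner integral, and hence the
  value of \<open>Lp_norm p f\<close>, is \<open>0\<close>; \<open>Lp_finite p f\<close> excludes this.
\<close>
definition Lp_finite :: "real \<Rightarrow> (real \<Rightarrow> real) \<Rightarrow> bool" where
  "Lp_finite p f \<longleftrightarrow> set_integrable lborel {0<..<1} (\<lambda>u. \<bar>f u\<bar> powr p)"

definition Lp_norm :: "real \<Rightarrow> (real \<Rightarrow> real) \<Rightarrow> real" where
  "Lp_norm p f = (LBINT u:{0<..<1}. \<bar>f u\<bar> powr p) powr (1 / p)"

definition node :: "nat \<Rightarrow> nat \<Rightarrow> real" where
  "node q k = real k / 2 ^ q"

definition cell :: "nat \<Rightarrow> nat \<Rightarrow> real set" where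
  "cell q k = {node q k <..< node q (Suc k)}"

definition last_cell :: "nat \<Rightarrow> nat" where
  "last_cell q = 2 ^ q - 1"

end

theory Submission
  imports Defs "HOL-Real_Asymp.Real_Asymp"
begin

text \<open>
  The Mills ratio estimates \<open>(1 + s) (1 - \<Phi>(s)) \<le> 2 \<phi>(s)\<close> and
  \<open>- ln (1 - \<Phi>(s)) \<le> 4 (1 + s)\<^sup>2\<close> show that \<open>- ln (1 - \<Phi>)\<close> increases on
  \<open>{x..}\<close> with slope at least a constant times \<open>sqrt (- ln (1 - \<Phi>(x)))\<close>.  Hence
  \<open>\<Phi>\<^sup>-\<^sup>1(b) - \<Phi>\<^sup>-\<^sup>1(a)\<close> is at most a constant times
  \<open>ln ((1 - a) / (1 - b)) / sqrt (- ln (1 - a))\<close> for \<open>1/2 \<le> a \<le> b < 1\<close>.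
  With \<open>1 - a = J / 2\<^sup>q\<close> the denominator is at least a constant times
  \<open>sqrt q / J\<^sup>1\<^sup>/\<^sup>4\<close>, so in the upper half the error at \<open>u\<close> is
  \<open>O(q\<^sup>-\<^sup>1\<^sup>/\<^sup>2)\<close> times a function of \<open>w = 2\<^sup>q (1 - u)\<close> whose \<open>p\<close>-th power is
  integrable over \<open>w > 0\<close>; the factor \<open>2\<^sup>-\<^sup>q\<close> comes from substituting \<open>w\<close> for \<open>u\<close>.
  The lower half follows by the symmetry \<open>u \<mapsto> 1 - u\<close>.
\<close>

section \<open>The standard normal distribution function and its inverse\<close>

lemma std_normal_density_DERIV:
  "(std_normal_density has_real_derivative - x * std_normal_density x) (at x)"
proof -
  have "((\<lambda>x. 1 / sqrt (2 * pi) * exp (- x\<^sup>2 / 2)) has_real_derivative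
     1 / sqrt (2 * pi) * (exp (- x\<^sup>2 / 2) * - x)) (at x)"
    by (rule derivative_eq_intros refl | simp)+
  then show ?thesis by (simp add: std_normal_density_def[abs_def] mult_ac)
qed

lemma Phi_diff_eq_integral:
  assumes "a \<le> x"
  shows "Phi x - Phi a = integral {a..x} std_normal_density"
proof -
  interpret real_distribution std_normal_distribution by (rule real_dist_normal_dist)
  have c: "continuous_on {a..x} std_normal_density"
    by (auto intro!: continuous_intros simp: std_normal_density_def[abs_def])
  have "Phi x - Phi a = measure std_normal_distribution {a<..x}"
    using assms by (cases "a = x") (simp_all add: Phi_def cdf_diff_eq)
  also have "\<dots> = (\<integral>u. indicator {a<..x} u \<partial>std_normal_distribution)"
    by simp
  also have "\<dots> = (LBINT u:{a<..x}. std_normal_density u)"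
    by (subst integral_density) (auto simp: set_lebesgue_integral_def mult_ac)
  also have "\<dots> = (LBINT u:{a..x}. std_normal_density u)"
    by (rule set_integral_cong_set)
       (auto simp: set_borel_measurable_def intro!: AE_I[where N="{a}"] split: split_indicator)
  also have "\<dots> = integral {a..x} std_normal_density"
    by (rule set_borel_integral_eq_integral, rule borel_integrable_compact[OF _ c, unfolded set_integrable_def[symmetric]])  simp
  finally show ?thesis .
qed

lemma Phi_DERIV: "(Phi has_real_derivative std_normal_density x) (at x)"
proof -
  have c: "continuous_on {x - 1..x + 1} std_normal_density"
    by (auto intro!: continuous_intros simp: std_normal_density_def[abs_def])
  have "((\<lambda>t. integral {x - 1..t} std_normal_density) has_real_derivative std_normal_density x)
      (at x within {x - 1..x + 1})"
    by (rule integral_has_real_derivative[OF c]) simp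
  then have "((\<lambda>t. Phi t - Phi (x - 1)) has_real_derivative std_normal_density x)
      (at x within {x - 1..x + 1})"
    by (rule has_field_derivative_transform_within[where d=1])
       (auto simp: Phi_diff_eq_integral)
  then have "((\<lambda>t. Phi t - Phi (x - 1)) has_real_derivative std_normal_density x) (at x)"
    by (subst (asm) at_within_interior) auto
  from DERIV_add[OF this DERIV_const[of "Phi (x - 1)"]] show ?thesis by simp
qed

lemma Phi_strict_mono: "x < y \<Longrightarrow> Phi x < Phi y"
  by (rule DERIV_pos_imp_increasing[where f=Phi]) (blast intro: Phi_DERIV normal_density_pos zero_less_one)+

lemma Phi_at_top: "(Phi \<longlongrightarrow> 1) at_top"
  and Phi_at_bot: "(Phi \<longlongrightarrow> 0) at_bot"
proof -
  interpret real_distribution std_normal_distribution by (rule real_dist_normal_dist)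
  show "(Phi \<longlongrightarrow> 1) at_top" "(Phi \<longlongrightarrow> 0) at_bot"
    using cdf_lim_at_top_prob cdf_lim_at_bot by (simp_all add: Phi_def[abs_def])
qed

text \<open>The density is even, so \<open>Phi x + Phi (- x)\<close> is constant; its limit at
  infinity is 1.\<close>

lemma Phi_minus: "Phi (- x) = 1 - Phi x"
proof -
  have "((\<lambda>x. Phi x + Phi (- x)) has_real_derivative 0) (at x)" for x
    by (auto intro!: derivative_eq_intros Phi_DERIV DERIV_chain2[where f=Phi]
        simp: std_normal_density_def)
  then have c: "Phi y + Phi (- y) = Phi x + Phi (- x)" for y
    using DERIV_isconst_all by blast
  have "((\<lambda>y. Phi y + Phi (- y)) \<longlongrightarrow> 1 + 0) at_top"
    by (intro tendsto_add Phi_at_top filterlim_compose[OF Phi_at_bot filterlim_uminus_at_bot_at_top])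
  moreover have "(\<lambda>y. Phi y + Phi (- y)) = (\<lambda>_. Phi x + Phi (- x))"
    using c by blast
  ultimately show ?thesis by (simp add: tendsto_const_iff)
qed

lemma Phi_less_1: "Phi x < 1"
proof -
  interpret real_distribution std_normal_distribution by (rule real_dist_normal_dist)
  show ?thesis
    using Phi_strict_mono[of x "x + 1"] cdf_bounded_prob[of "x + 1"] by (simp add: Phi_def)
qed

lemma Phi_inv_Phi: "Phi_inv (Phi x) = x"
proof -
  have "inj Phi" by (rule linorder_injI) (auto dest: Phi_strict_mono)
  then show ?thesis by (simp add: Phi_inv_def)
qed

lemma Phi_Phi_inv:
  assumes "0 < u" "u < 1"
  shows "Phi (Phi_inv u) = u"
proof -
  obtain a where a: "Phi a < u"
    using order_tendstoD(2)[OF Phi_at_bot assms(1)] eventually_happens by force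
  obtain b where b: "u < Phi b"
    using order_tendstoD(1)[OF Phi_at_top assms(2)] eventually_happens by force
  have "a \<le> b" using a b Phi_strict_mono[of b a] by linarith
  then obtain x where "Phi x = u"
    using IVT[of Phi a u b] a b DERIV_isCont[OF Phi_DERIV] by force
  then show ?thesis by (metis Phi_inv_Phi)
qed

lemma Phi_inv_mono:
  assumes "0 < u" "u \<le> v" "v < 1"
  shows "Phi_inv u \<le> Phi_inv v"
proof (rule ccontr)
  assume "\<not> Phi_inv u \<le> Phi_inv v"
  then have "Phi (Phi_inv v) < Phi (Phi_inv u)" by (intro Phi_strict_mono) simp
  then show False using assms by (simp add: Phi_Phi_inv)
qed

lemma Phi_inv_one_minus:
  assumes "0 < u" "u < 1"
  shows "Phi_inv (1 - u) = - Phi_inv u"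
  using Phi_inv_Phi[of "- Phi_inv u"] assms by (simp add: Phi_minus Phi_Phi_inv)

lemma Phi_inv_nonneg:
  assumes "1 / 2 \<le> u" "u < 1"
  shows "0 \<le> Phi_inv u"
  using Phi_inv_mono[of "1 - u" u] assms by (simp add: Phi_inv_one_minus)

section \<open>Tail estimates for the normal distribution\<close>

lemma Mills_upper:
  assumes "0 \<le> s"
  shows "(1 + s) * (1 - Phi s) \<le> 2 * std_normal_density s"
proof -
  \<comment> \<open>\<open>H\<close> is antitone and vanishes at infinity, so it is nonnegative.\<close>
  define H where "H s = 2 * std_normal_density s / (1 + s) - (1 - Phi s)" for s
  have "\<exists>d. (H has_real_derivative d) (at t) \<and> d \<le> 0" if "s \<le> t" for t
  proof -
    have t: "0 \<le> t" using that assms by simp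
    let ?d = "2 * ((- t * std_normal_density t) * (1 + t) - std_normal_density t) / (1 + t)\<^sup>2
      + std_normal_density t"
    have "(H has_real_derivative ?d) (at t)"
      unfolding H_def using t
      by (auto intro!: derivative_eq_intros Phi_DERIV std_normal_density_DERIV
          simp: power2_eq_square algebra_simps)
    moreover have "?d = - (std_normal_density t * ((1 + t\<^sup>2) / (1 + t)\<^sup>2))"
      using t by (simp add: divide_simps) (simp add: algebra_simps power2_eq_square)
    then have "?d \<le> 0" by (simp add: std_normal_density_def)
    ultimately show ?thesis by blast
  qed
  then have "H t \<le> H s" if "s \<le> t" for t
    using DERIV_nonpos_imp_nonincreasing[OF that, of H] by blast
  then have ev: "eventually (\<lambda>t. H t \<le> H s) at_top"
    by (rule eventually_mono[OF eventually_ge_at_top])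
  have "((\<lambda>t. 2 * std_normal_density t / (1 + t)) \<longlongrightarrow> 0) at_top"
    unfolding std_normal_density_def by real_asymp
  then have "(H \<longlongrightarrow> 0 - (1 - 1)) at_top"
    unfolding H_def by (intro tendsto_intros Phi_at_top)
  from tendsto_upperbound[OF this ev] have "0 \<le> H s" by simp
  then show ?thesis using assms by (simp add: H_def field_simps)
qed

text \<open>The tail beyond \<open>s\<close> contains the mass of the unit interval after
  \<open>s\<close>, which the mean value theorem turns into a density value at a point below
  \<open>s + 1\<close>.\<close>

lemma Mills_lower:
  assumes "0 \<le> s"
  shows "- ln (1 - Phi s) \<le> (2 * (1 + s))\<^sup>2"
proof -
  obtain z where z: "s < z" "z < s + 1" "Phi (s + 1) - Phi s = std_normal_density z"
    using MVT2[of s "s + 1" Phi std_normal_density] Phi_DERIV by auto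
  have "sqrt (2 * pi) \<le> 3"
    by (rule real_le_lsqrt) (use pi_less_4 in auto)
  also have "3 \<le> exp (2::real)" using exp_ge_add_one_self[of 2] by simp
  finally have "exp (- 2) \<le> 1 / sqrt (2 * pi)"
    by (simp add: exp_minus field_simps)
  moreover have "z\<^sup>2 \<le> (1 + s)\<^sup>2" using z assms by (intro power_mono) auto
  then have "exp (- (1 + s)\<^sup>2 / 2) \<le> exp (- z\<^sup>2 / 2)" by simp
  ultimately have "exp (- 2) * exp (- (1 + s)\<^sup>2 / 2) \<le> std_normal_density z"
    unfolding std_normal_density_def by (intro mult_mono) auto
  also have "\<dots> \<le> 1 - Phi s" using z(3) Phi_less_1[of "s + 1"] by simp
  finally have "exp (- (2 + (1 + s)\<^sup>2 / 2)) \<le> 1 - Phi s"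
    by (simp add: exp_add[symmetric])
  then have "- (2 + (1 + s)\<^sup>2 / 2) \<le> ln (1 - Phi s)"
    using Phi_less_1[of s] by (subst ln_ge_iff) auto
  \<comment> \<open>This absorbs the additive 2 into a multiple of the square.\<close>
  moreover have "1 \<le> (1 + s)\<^sup>2" using assms by simp
  ultimately show ?thesis unfolding power_mult_distrib by simp
qed

text \<open>The derivative of \<open>- ln (1 - Phi t)\<close> is the hazard rate, at least
  \<open>(1 + t) / 2\<close> by \<open>Mills_upper\<close>, while \<open>Mills_lower\<close> bounds
  the square root, frozen at \<open>x\<close>, by \<open>2 * (1 + x)\<close>.\<close>

lemma Phi_log_tail_increment:
  assumes "0 \<le> x" "x \<le> y"
  shows "(y - x) * sqrt (- ln (1 - Phi x)) \<le> 4 * (ln (1 - Phi x) - ln (1 - Phi y))"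
proof -
  define c where "c = sqrt (- ln (1 - Phi x))"
  have c: "c \<le> 2 * (1 + x)"
    unfolding c_def using Mills_lower[OF assms(1)] assms by (intro real_le_lsqrt) auto
  have "\<exists>d. ((\<lambda>s. - 4 * ln (1 - Phi s) - s * c) has_real_derivative d) (at t) \<and> 0 \<le> d"
    if "x \<le> t" for t
  proof -
    have "c \<le> 2 * (1 + t)" using c that by simp
    also have "\<dots> \<le> 4 * (std_normal_density t / (1 - Phi t))"
      using Mills_upper[of t] Phi_less_1[of t] that assms by (simp add: field_simps)
    finally have "0 \<le> 4 * (std_normal_density t / (1 - Phi t)) - c" by simp
    moreover have "((\<lambda>s. - 4 * ln (1 - Phi s) - s * c) has_real_derivative
        4 * (std_normal_density t / (1 - Phi t)) - c) (at t)"
      using Phi_less_1[of t] by (auto intro!: derivative_eq_intros Phi_DERIV)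
    ultimately show ?thesis by blast
  qed
  from DERIV_nonneg_imp_nondecreasing[OF assms(2), of "\<lambda>s. - 4 * ln (1 - Phi s) - s * c"] this
  have "- 4 * ln (1 - Phi x) - x * c \<le> - 4 * ln (1 - Phi y) - y * c" by blast
  then show ?thesis unfolding c_def[symmetric] by (simp add: algebra_simps)
qed

section \<open>Increments of the quantile function\<close>

lemma Phi_inv_increment:
  assumes "1 / 2 \<le> a" "a \<le> b" "b < 1"
  shows "(Phi_inv b - Phi_inv a) * sqrt (- ln (1 - a)) \<le> 4 * ln ((1 - a) / (1 - b))"
proof -
  have "Phi_inv a \<le> Phi_inv b" "0 \<le> Phi_inv a"
    using assms by (auto intro: Phi_inv_nonneg Phi_inv_mono)
  from Phi_log_tail_increment[OF this(2,1)] show ?thesis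
    using assms by (simp add: Phi_Phi_inv ln_div)
qed

text \<open>Since \<open>r = q * ln 2 - ln J\<close>, the term \<open>ln J\<close> must be traded
  for a power of \<open>J\<close>. The power \<open>sqrt J\<close> is small enough that the inner
  cell bounds, of order \<open>J powr (- 3 / 4)\<close>, stay square summable.\<close>

lemma log_tail_ge:
  assumes J: "1 \<le> J" "2 * J \<le> 2 ^ q"
  defines "r \<equiv> - ln (J / 2 ^ q)"
  shows "1 / 2 \<le> r" "real q \<le> 8 * r * sqrt J"
proof -
  have ln2: "1 / 2 \<le> ln (2::real)" using ln2_ge_two_thirds by simp
  have "J / 2 ^ q \<le> 1 / 2" using J by (simp add: field_simps)
  then have "ln (J / 2 ^ q) \<le> ln (1 / 2)" using J by (subst ln_le_cancel_iff) auto
  then show r: "1 / 2 \<le> r" using ln2 by (simp add: r_def ln_div)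
  have s: "1 \<le> sqrt J" using J by simp
  have "ln J = 2 * ln (sqrt J)" using J by (simp add: ln_sqrt)
  also have "\<dots> \<le> 2 * (sqrt J - 1)" using s ln_le_minus_one[of "sqrt J"] by simp
  also have "\<dots> \<le> 4 * r * (sqrt J - 1)" using s r by (intro mult_right_mono) auto
  finally have lnJ: "ln J \<le> 4 * r * (sqrt J - 1)" .
  have "real q * (1 / 2) \<le> real q * ln 2" using ln2 by (intro mult_left_mono) auto
  also have "\<dots> = r + ln J" using J by (simp add: r_def ln_div ln_realpow)
  also have "\<dots> \<le> 4 * r * sqrt J" using lnJ r by (simp add: algebra_simps)
  finally show "real q \<le> 8 * r * sqrt J" by simp
qed

text \<open>\<open>J\<close> measures the distance of the left endpoint from 1 in mesh units.
  \<open>b\<close> stays free because the last cell needs \<open>b = u\<close>, its right node 1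
  having no quantile.\<close>

lemma Phi_inv_increment_dyadic:
  fixes J b :: real
  assumes q: "0 < q" and J: "1 \<le> J" "2 * J \<le> 2 ^ q" and b: "1 - J / 2 ^ q \<le> b" "b < 1"
  shows "Phi_inv b - Phi_inv (1 - J / 2 ^ q)
    \<le> 12 * real q powr (- 1 / 2) * (J powr (1 / 4) * ln (J / (2 ^ q * (1 - b))))"
proof -
  define r where "r = - ln (J / 2 ^ q)"
  define d where "d = Phi_inv b - Phi_inv (1 - J / 2 ^ q)"
  note r = log_tail_ge[OF J, folded r_def]
  have a: "1 / 2 \<le> 1 - J / 2 ^ q" using J by (simp add: field_simps)
  have d0: "0 \<le> d" unfolding d_def diff_ge_0_iff_ge using J a b by (intro Phi_inv_mono) auto
  \<comment> \<open>Rounding 8 up to 9 gives the constant a whole square root.\<close>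
  have "8 * (r * sqrt J) \<le> 9 * (r * sqrt J)" using r(1) J by (intro mult_right_mono) auto
  with r(2) have "real q \<le> 9 * r * sqrt J" by simp
  then have "sqrt (real q) \<le> sqrt (9 * r * sqrt J)" by (rule real_sqrt_le_mono)
  also have "sqrt (9 * r * sqrt J) = 3 * sqrt r * sqrt (sqrt J)"
    by (simp add: real_sqrt_mult)
  also have "sqrt (sqrt J) = (J powr (1 / 2)) powr (1 / 2)"
    using J by (simp add: powr_half_sqrt)
  also have "\<dots> = J powr (1 / 4)" unfolding powr_powr by simp
  finally have "d * sqrt (real q) \<le> d * (3 * sqrt r * J powr (1 / 4))"
    using d0 by (intro mult_left_mono)
  also have "\<dots> = (d * sqrt r) * (3 * J powr (1 / 4))" by simp
  also have "d * sqrt r \<le> 4 * ln (J / 2 ^ q / (1 - b))"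
    using Phi_inv_increment[OF a b] by (simp add: d_def r_def)
  then have "(d * sqrt r) * (3 * J powr (1 / 4))
      \<le> (4 * ln (J / 2 ^ q / (1 - b))) * (3 * J powr (1 / 4))"
    by (intro mult_right_mono) auto
  finally have "d * sqrt (real q) \<le> 12 * (J powr (1 / 4) * ln (J / (2 ^ q * (1 - b))))"
    by (simp add: mult_ac)
  then show ?thesis
    using q unfolding d_def[symmetric]
    by (simp add: powr_minus powr_half_sqrt field_simps)
qed

section \<open>Integrable majorant and error bound on one cell\<close>

text \<open>
  An integrable majorant in the rescaled distance \<open>w = 2\<^sup>q (1 - u)\<close> to the endpoint: the
  first term absorbs the logarithmic singularity of \<open>Phi_inv\<close> in the last cell, the second
  the increments over the inner cells.
\<close>

definition tail_weight :: "real \<Rightarrow> real" where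
  "tail_weight w = (if 0 < w \<and> w \<le> 1 then w powr (- 1 / 2) else 0)
    + (if 1 \<le> w then w powr (- 3 / 2) else 0)"

lemma tail_weight_nonneg: "0 \<le> tail_weight w"
  by (simp add: tail_weight_def)

lemma integrable_tail_weight: "integrable lborel tail_weight"
proof -
  have "(\<lambda>w::real. w powr (- 1 / 2)) absolutely_integrable_on {0<..1}"
    by (subst absolutely_integrable_on_iff_nonneg) (auto intro: integrable_on_powr_from_0')
  then have 1: "integrable lborel (\<lambda>w::real. indicator {0<..1} w *\<^sub>R w powr (- 1 / 2))"
    unfolding set_integrable_def by (subst (asm) integrable_completion) auto
  have "(\<lambda>w::real. w powr (- 3 / 2)) absolutely_integrable_on {1..}"
    using has_integral_integrable[OF has_integral_powr_to_inf[of "- 3 / 2" 1]]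
    by (subst absolutely_integrable_on_iff_nonneg) auto
  then have 2: "integrable lborel (\<lambda>w::real. indicator {1..} w *\<^sub>R w powr (- 3 / 2))"
    unfolding set_integrable_def by (subst (asm) integrable_completion) auto
  have "tail_weight = (\<lambda>w. indicator {0<..1} w *\<^sub>R w powr (- 1 / 2) + indicator {1..} w *\<^sub>R w powr (- 3 / 2))"
    by (auto simp: tail_weight_def fun_eq_iff split: split_indicator)
  with Bochner_Integration.integrable_add[OF 1 2] show ?thesis by simp
qed

text \<open>Allowing \<open>A \<le> M\<close> lets the inner cells and the last cell share one
  constant.\<close>

lemma powr_tail_bound:
  assumes "\<bar>d\<bar> \<le> A * real q powr (- 1 / 2) * t" and "0 \<le> A" "0 \<le> t" "0 \<le> p" "A \<le> M"
    and "t powr p \<le> tail_weight w"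
  shows "\<bar>d\<bar> powr p \<le> M powr p * real q powr (- p / 2) * tail_weight w"
proof -
  have "\<bar>d\<bar> powr p \<le> (A * real q powr (- 1 / 2) * t) powr p"
    using assms by (intro powr_mono2) auto
  also have "\<dots> = A powr p * real q powr (- p / 2) * t powr p"
    using assms by (simp add: powr_mult powr_powr)
  also have "\<dots> \<le> M powr p * real q powr (- p / 2) * tail_weight w"
    using assms by (intro mult_mono[OF mult_right_mono] powr_mono2) auto
  finally show ?thesis .
qed

text \<open>In an inner cell \<open>y\<close> and \<open>Phi_inv u\<close> both lie between the
  quantiles of the two nodes, so one increment bounds their distance. In the last cell
  \<open>Phi_inv\<close> is unbounded, and its logarithmic growth is added to the slack allowed by
  \<open>C\<close>.\<close>

lemma upper_cell_bound:
  assumes q: "1 < q" and k: "2 ^ q \<le> 2 * k" "k < 2 ^ q" and u: "u \<in> cell q k"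
    and lower: "Phi_inv (node q k) \<le> y"
    and upper: "k < last_cell q \<Longrightarrow> y \<le> Phi_inv (node q (k + 1))"
    and last: "k = last_cell q \<Longrightarrow> y \<le> Phi_inv (node q k) + C * real q powr (- 1 / 2)"
    and p: "2 \<le> p"
  shows "\<bar>y - Phi_inv u\<bar> powr p
    \<le> (24 * p + \<bar>C\<bar>) powr p * real q powr (- p / 2) * tail_weight (2 ^ q * (1 - u))"
proof -
  \<comment> \<open>\<open>j\<close> counts the cells to the right of cell \<open>k\<close>, so
    \<open>w\<close> lies strictly between \<open>j\<close> and \<open>j + 1\<close>, and
    \<open>j = 0\<close> is the last cell.\<close>
  define j where "j = 2 ^ q - 1 - k"
  define w where "w = 2 ^ q * (1 - u)"
  have kj: "real k = 2 ^ q - (real j + 1)" and j2: "2 * (real j + 1) \<le> 2 ^ q"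
  proof -
    have "k + j + 1 = 2 ^ q" using k by (simp add: j_def)
    then have "real k + real j + 1 = 2 ^ q" by (metis of_nat_add of_nat_1 of_nat_numeral of_nat_power)
    moreover have "(2::real) ^ q \<le> 2 * real k"
      using k(1) by (metis of_nat_le_iff of_nat_mult of_nat_numeral of_nat_power)
    ultimately show "real k = 2 ^ q - (real j + 1)" "2 * (real j + 1) \<le> 2 ^ q"
      by (simp_all add: algebra_simps)
  qed
  have node_k: "node q k = 1 - (real j + 1) / 2 ^ q"
    and node_Suc: "node q (Suc k) = 1 - real j / 2 ^ q"
    using kj by (simp_all add: node_def diff_divide_distrib add_divide_distrib)
  have u': "node q k < u" "u < node q (Suc k)" using u by (simp_all add: cell_def)
  have "0 \<le> real j / 2 ^ q" by simp
  with u' have u1: "u < 1" unfolding node_Suc by linarith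
  have w: "real j < w" "w < real j + 1"
    using u' unfolding node_k node_Suc w_def by (simp_all add: field_simps)
  have nk: "1 / 2 \<le> node q k" using j2 unfolding node_k by (simp add: field_simps)
  have mono: "Phi_inv (node q k) \<le> Phi_inv u" using u' u1 nk by (intro Phi_inv_mono) auto
  have incr: "Phi_inv b - Phi_inv (node q k) \<le> 12 * real q powr (- 1 / 2) *
      ((real j + 1) powr (1 / 4) * ln ((real j + 1) / (2 ^ q * (1 - b))))"
    if "node q k \<le> b" "b < 1" for b
    using Phi_inv_increment_dyadic[of q "real j + 1" b] that q j2 unfolding node_k by simp
  show ?thesis
  proof (cases "k = last_cell q")
    case False
    with k have kl: "k < last_cell q" by (simp add: last_cell_def)
    then have j: "1 \<le> j" by (simp add: j_def last_cell_def)
    have b: "node q k \<le> node q (Suc k)" "node q (Suc k) < 1"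
      using u' j by (simp_all add: node_Suc)
    have "Phi_inv u \<le> Phi_inv (node q (Suc k))" using u' b nk by (intro Phi_inv_mono) auto
    then have "\<bar>y - Phi_inv u\<bar> \<le> Phi_inv (node q (Suc k)) - Phi_inv (node q k)"
      using lower upper[OF kl] mono by auto
    also have "\<dots> \<le> 12 * real q powr (- 1 / 2) * ((real j + 1) powr (1 / 4) * ln ((real j + 1) / real j))"
      using incr[OF b] by (simp add: node_Suc)
    also have "\<dots> \<le> 12 * real q powr (- 1 / 2) * ((real j + 1) powr (1 / 4) * (2 / (real j + 1)))"
    proof -
      have "ln ((real j + 1) / real j) \<le> (real j + 1) / real j - 1"
        using j by (intro ln_le_minus_one) simp
      also have "\<dots> = 1 / real j" using j by (simp add: field_simps)
      also have "\<dots> \<le> 2 / (real j + 1)" using j by (simp add: field_simps)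
      finally show ?thesis by (intro mult_left_mono) auto
    qed
    also have "\<dots> = 24 * real q powr (- 1 / 2) * (real j + 1) powr (- 3 / 4)"
    proof -
      have "(real j + 1) powr (1 / 4) * (2 / (real j + 1)) = 2 * (real j + 1) powr (1 / 4 - 1)"
        by (simp only: powr_diff) simp
      then show ?thesis by simp
    qed
    also have "\<dots> \<le> 24 * real q powr (- 1 / 2) * w powr (- 3 / 4)"
      using w j by (intro mult_left_mono powr_mono2') auto
    finally have "\<bar>y - Phi_inv u\<bar> \<le> 24 * real q powr (- 1 / 2) * w powr (- 3 / 4)" .
    moreover have "(w powr (- 3 / 4)) powr p \<le> tail_weight w"
    proof -
      have w1: "1 < w" using w j by linarith
      \<comment> \<open>Here \<open>p \<ge> 2\<close> enters: it pushes the exponent below -1, as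
        integrability at infinity demands.\<close>
      have "(w powr (- 3 / 4)) powr p \<le> w powr (- 3 / 2)"
        unfolding powr_powr using w1 p by (intro powr_mono) auto
      with w1 show ?thesis by (simp add: tail_weight_def)
    qed
    ultimately show ?thesis
      unfolding w_def[symmetric] using p by (intro powr_tail_bound[where A=24]) auto
  next
    case True
    then have j: "j = 0" by (simp add: j_def last_cell_def)
    with w have w01: "0 < w" "w < 1" by auto
    \<comment> \<open>The exponent makes \<open>t powr p\<close> equal to
      \<open>w powr (- 1 / 2)\<close>, the majorant near 0, while \<open>ln (1 / w)\<close>, being
      \<open>2 * p * ln t\<close>, is still at most \<open>2 * p * t\<close>.\<close>
    define t where "t = w powr (- 1 / (2 * p))"
    have t1: "1 \<le> t" using powr_mono2'[of "- 1 / (2 * p)" w 1] w01 p by (simp add: t_def)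
    have "ln (1 / w) = 2 * p * ln t" using w01 p by (simp add: t_def ln_powr ln_div)
    also have "\<dots> \<le> 2 * p * t" using t1 p ln_le_minus_one[of t] by (intro mult_left_mono) auto
    finally have lnw: "ln (1 / w) \<le> 2 * p * t" .
    have "Phi_inv u - Phi_inv (node q k) \<le> 12 * real q powr (- 1 / 2) * ln (1 / w)"
      using incr[of u] u' u1 by (simp add: j w_def)
    also have "\<dots> \<le> 12 * real q powr (- 1 / 2) * (2 * p * t)"
      using lnw by (intro mult_left_mono) auto
    finally have 1: "Phi_inv u - Phi_inv (node q k) \<le> 24 * p * real q powr (- 1 / 2) * t"
      by (simp add: mult_ac)
    have "C * real q powr (- 1 / 2) \<le> \<bar>C\<bar> * real q powr (- 1 / 2) * 1"
      by (simp add: mult_right_mono)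
    also have "\<dots> \<le> \<bar>C\<bar> * real q powr (- 1 / 2) * t" using t1 by (intro mult_left_mono) auto
    finally have 2: "C * real q powr (- 1 / 2) \<le> \<bar>C\<bar> * real q powr (- 1 / 2) * t" .
    have nn: "0 \<le> 24 * p * real q powr (- 1 / 2) * t" "0 \<le> \<bar>C\<bar> * real q powr (- 1 / 2) * t"
      using p t1 by auto
    have "\<bar>y - Phi_inv u\<bar> \<le> 24 * p * real q powr (- 1 / 2) * t + \<bar>C\<bar> * real q powr (- 1 / 2) * t"
      using lower last[OF True] mono 1 2 nn by linarith
    then have "\<bar>y - Phi_inv u\<bar> \<le> (24 * p + \<bar>C\<bar>) * real q powr (- 1 / 2) * t"
      by (simp add: algebra_simps)
    moreover have "t powr p \<le> tail_weight w"
      using w01 p by (simp add: t_def powr_powr tail_weight_def)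
    ultimately show ?thesis
      unfolding w_def[symmetric] using p t1
      by (intro powr_tail_bound[where A="24 * p + \<bar>C\<bar>"]) auto
  qed
qed

section \<open>Cells, reflection, measurability and rescaling\<close>

lemma in_cell_nat_floor:
  assumes "0 < u" "u < 1" "u \<notin> node q ` {..2 ^ q}"
  shows "nat \<lfloor>u * 2 ^ q\<rfloor> < 2 ^ q" "u \<in> cell q (nat \<lfloor>u * 2 ^ q\<rfloor>)"
proof -
  define k where "k = nat \<lfloor>u * 2 ^ q\<rfloor>"
  have "real k = of_int \<lfloor>u * 2 ^ q\<rfloor>" using assms by (simp add: k_def)
  then have k: "real k \<le> u * 2 ^ q" "u * 2 ^ q < real k + 1" by linarith+
  have "u * 2 ^ q < 2 ^ q" using assms by simp
  with k have "real k < real (2 ^ q)" by (simp only: of_nat_power of_nat_numeral)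
  then show kq: "nat \<lfloor>u * 2 ^ q\<rfloor> < 2 ^ q" unfolding k_def[symmetric] by (simp only: of_nat_less_iff)
  then have "node q k \<in> node q ` {..2 ^ q}" unfolding k_def by (intro imageI) simp
  with assms(3) have "node q k \<noteq> u" by blast
  then show "u \<in> cell q (nat \<lfloor>u * 2 ^ q\<rfloor>)"
    using k unfolding k_def[symmetric] cell_def node_def by (auto simp: field_simps)
qed

lemma cell_reflect:
  assumes "u \<in> cell q k" "k < 2 ^ q"
  shows "1 - u \<in> cell q (last_cell q - k)"
proof -
  have "real (last_cell q - k) = 2 ^ q - 1 - real k"
    using assms(2) by (simp add: last_cell_def of_nat_diff)
  then show ?thesis using assms(1) by (simp add: cell_def node_def field_simps)
qed

lemma measurable_Phi_inv: "(\<lambda>u. indicator {0<..<1} u *\<^sub>R Phi_inv u) \<in> borel_measurable lborel"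
proof -
  have "mono_on {0<..<1} Phi_inv" by (auto intro!: mono_onI Phi_inv_mono)
  from borel_measurable_mono_on_fnc[OF this] show ?thesis
    by (subst (asm) borel_measurable_restrict_space_iff) auto
qed

text \<open>Both substitutions have Jacobian \<open>2 ^ q\<close> in absolute value, which is the
  source of the exponential decay; the 2 counts the two ends of the unit interval.\<close>

lemma tail_weight_affine:
  fixes q :: nat
  shows "integrable lborel (\<lambda>u. tail_weight (2 ^ q * u) + tail_weight (2 ^ q * (1 - u)))"
    and "(LBINT u. tail_weight (2 ^ q * u) + tail_weight (2 ^ q * (1 - u)))
      = 2 * (LBINT w. tail_weight w) / 2 ^ q"
proof -
  let ?N = "2 ^ q :: real"
  have e: "2 ^ q * (1 - u) = ?N + - ?N * u" for u by (simp add: algebra_simps)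
  have 1: "integrable lborel (\<lambda>u. tail_weight (?N * u))"
    using lborel_integrable_real_affine[OF integrable_tail_weight, of ?N 0] by simp
  have 2: "integrable lborel (\<lambda>u. tail_weight (?N * (1 - u)))"
    using lborel_integrable_real_affine[OF integrable_tail_weight, of "- ?N" ?N]
    by (simp add: algebra_simps)
  show "integrable lborel (\<lambda>u. tail_weight (2 ^ q * u) + tail_weight (2 ^ q * (1 - u)))"
    using 1 2 by simp
  have "(LBINT w. tail_weight w) = ?N * (LBINT u. tail_weight (?N * u))"
    using lborel_integral_real_affine[of ?N tail_weight 0] by simp
  moreover have "(LBINT w. tail_weight w) = ?N * (LBINT u. tail_weight (?N * (1 - u)))"
    using lborel_integral_real_affine[of "- ?N" tail_weight ?N] by (simp add: algebra_simps)
  ultimately show "(LBINT u. tail_weight (2 ^ q * u) + tail_weight (2 ^ q * (1 - u)))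
      = 2 * (LBINT w. tail_weight w) / 2 ^ q"
    using 1 2 by (simp add: field_simps)
qed

section \<open>Assembly of the estimate over the unit interval\<close>

theorem theorem2p3:
  fixes Q :: "nat \<Rightarrow> real \<Rightarrow> real"
    and Qc :: "nat \<Rightarrow> nat \<Rightarrow> real"
    and C :: real
    and p :: nat
  assumes piecewise_const:
      "\<And>q k u. q > 1 \<Longrightarrow> k \<in> {0..last_cell q} \<Longrightarrow> u \<in> cell q k \<Longrightarrow> Q q u = Qc q k"
    and antisymmetric:
      "\<And>q k. q > 1 \<Longrightarrow> k \<in> {0..last_cell q} \<Longrightarrow> Qc q k = - Qc q (last_cell q - k)"
    and inner:
      "\<And>q k. q > 1 \<Longrightarrow> k \<in> {1..last_cell q - 1} \<Longrightarrow>
         Phi_inv (node q k) \<le> Qc q k \<and> Qc q k \<le> Phi_inv (node q (k + 1))"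
    and outer:
      "\<And>q. q > 1 \<Longrightarrow>
         Phi_inv (node q (last_cell q)) \<le> Qc q (last_cell q) \<and>
         Qc q (last_cell q) \<le> Phi_inv (node q (last_cell q)) + C * real q powr (- 1 / 2)"
    and "even p" and "p \<ge> 2"
  shows "(\<forall>q>1. Lp_finite (real p) (\<lambda>u. Q q u - Phi_inv u)) \<and>
    (\<lambda>q. Lp_norm (real p) (\<lambda>u. Q q u - Phi_inv u) ^ p)
      \<in> O(\<lambda>q. 2 powr (- real q) * real q powr (- real p / 2))"
proof -
  define M where "M = (24 * real p + \<bar>C\<bar>) powr real p"
  \<comment> \<open>Adding the mirror image makes \<open>W\<close>, and hence \<open>g\<close>,
    invariant under \<open>u \<mapsto> 1 - u\<close>, so one majorant serves both halves.\<close>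
  define W where "W q u = tail_weight (2 ^ q * u) + tail_weight (2 ^ q * (1 - u))" for q :: nat and u
  define f where "f q u = indicator {0<..<1} u *\<^sub>R \<bar>Q q u - Phi_inv u\<bar> powr real p" for q u
  define g where "g q u = M * real q powr (- real p / 2) * W q u" for q u
  have p: "2 \<le> real p" using \<open>p \<ge> 2\<close> by simp
  have W_nonneg: "0 \<le> W q u" for q u by (simp add: W_def tail_weight_nonneg)
  then have g_nonneg: "0 \<le> g q u" for q u by (simp add: g_def M_def)

  have upper_half: "\<bar>Qc q k - Phi_inv u\<bar> powr real p \<le> g q u"
    if "1 < q" "2 ^ q \<le> 2 * k" "k < 2 ^ q" "u \<in> cell q k" for q k u
  proof -
    \<comment> \<open>The upper half excludes \<open>k = 0\<close>, the one cell on which neither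
      \<open>inner\<close> nor \<open>outer\<close> speaks.\<close>
    have k1: "1 \<le> k" "k \<le> last_cell q"
      using that by (auto simp: last_cell_def intro: ccontr)
    have "\<bar>Qc q k - Phi_inv u\<bar> powr real p
        \<le> M * real q powr (- real p / 2) * tail_weight (2 ^ q * (1 - u))"
      unfolding M_def
    proof (rule upper_cell_bound[OF that])
      show "Phi_inv (node q k) \<le> Qc q k"
        using inner[OF \<open>1 < q\<close>, of k] outer[OF \<open>1 < q\<close>] k1 by (cases "k = last_cell q") auto
      show "Qc q k \<le> Phi_inv (node q (k + 1))" if "k < last_cell q"
        using inner[OF \<open>1 < q\<close>, of k] k1 that by auto
      show "Qc q k \<le> Phi_inv (node q k) + C * real q powr (- 1 / 2)" if "k = last_cell q"
        using outer[OF \<open>1 < q\<close>] that by simp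
    qed (rule p)
    also have "\<dots> \<le> g q u"
      unfolding g_def W_def by (intro mult_left_mono) (auto simp: M_def tail_weight_nonneg)
    finally show ?thesis .
  qed

  have bound: "\<bar>Q q u - Phi_inv u\<bar> powr real p \<le> g q u"
    if q: "1 < q" and u: "0 < u" "u < 1" "u \<notin> node q ` {..2 ^ q}" for q u
  proof -
    define k where "k = nat \<lfloor>u * 2 ^ q\<rfloor>"
    note k = in_cell_nat_floor[OF u, folded k_def]
    have kl: "k \<in> {0..last_cell q}" using k(1) by (auto simp: last_cell_def)
    have Q: "Q q u = Qc q k" by (rule piecewise_const[OF q kl k(2)])
    show ?thesis
    proof (cases "2 ^ q \<le> 2 * k")
      case True
      with upper_half[OF q True k] Q show ?thesis by simp
    next
      case False
      \<comment> \<open>By parity \<open>2 * k < 2 ^ q\<close> improves to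
        \<open>2 * k + 2 \<le> 2 ^ q\<close>, so the reflected index lands in the upper half despite
        the offset 1 in \<open>last_cell\<close>.\<close>
      have "even ((2::nat) ^ q)" using q by simp
      with False have "2 ^ q \<le> 2 * (last_cell q - k)"
        unfolding last_cell_def by presburger
      from upper_half[OF q this _ cell_reflect[OF k(2,1)]]
      have "\<bar>Qc q (last_cell q - k) - Phi_inv (1 - u)\<bar> powr real p \<le> g q (1 - u)"
        by (simp add: last_cell_def)
      moreover have "g q (1 - u) = g q u" by (simp add: g_def W_def)
      moreover have "\<bar>Qc q (last_cell q - k) - Phi_inv (1 - u)\<bar> = \<bar>Q q u - Phi_inv u\<bar>"
        using antisymmetric[OF q kl] Q u by (simp add: Phi_inv_one_minus)
      ultimately show ?thesis by simp
    qed
  qed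

  have meas: "f q \<in> borel_measurable lborel" if q: "1 < q" for q
  proof (rule measurable_discrete_difference)
    \<comment> \<open>\<open>Q q\<close> is arbitrary at the nodes. \<open>?h\<close> reads the cell
      index off a floor, is visibly measurable and agrees with \<open>f q\<close> outside the finite
      set of nodes.\<close>
    let ?h = "\<lambda>u. indicator {0<..<1} u *\<^sub>R
      \<bar>Qc q (nat \<lfloor>u * 2 ^ q\<rfloor>) - indicator {0<..<1} u *\<^sub>R Phi_inv u\<bar> powr real p"
    note [measurable] = measurable_Phi_inv
    show "?h \<in> borel_measurable lborel" by measurable
    show "?h u = f q u" if "u \<notin> node q ` {..2 ^ q}" for u
    proof (cases "0 < u \<and> u < 1")
      case True
      define k where "k = nat \<lfloor>u * 2 ^ q\<rfloor>"
      from True that have "k < 2 ^ q" "u \<in> cell q k"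
        unfolding k_def by (auto intro!: in_cell_nat_floor simp del: nat_less_numeral_power_cancel_iff)
      then have "Q q u = Qc q k" by (intro piecewise_const[OF q]) (auto simp: last_cell_def)
      with True show ?thesis by (simp add: f_def k_def)
    qed (auto simp: f_def)
  qed auto

  have g_int: "integrable lborel (g q)" for q
    unfolding g_def W_def by (intro integrable_mult_right tail_weight_affine)
  have AE_bound: "AE u in lborel. f q u \<le> g q u" if q: "1 < q" for q
  proof (rule AE_I')
    show "node q ` {..2 ^ q} \<in> null_sets lborel" by (intro finite_imp_null_set_lborel) simp
    show "{u \<in> space lborel. \<not> f q u \<le> g q u} \<subseteq> node q ` {..2 ^ q}"
    proof -
      have "f q u \<le> g q u" if "u \<notin> node q ` {..2 ^ q}" for u
        using bound[OF q _ _ that] g_nonneg[of q u] by (cases "0 < u \<and> u < 1") (auto simp: f_def)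
      then show ?thesis by blast
    qed
  qed
  have f_nonneg: "0 \<le> f q u" for q u by (simp add: f_def)
  \<comment> \<open>Domination by \<open>g q\<close> yields integrability, so the integrals below
    are genuine and not the default value 0.\<close>
  have f_int: "integrable lborel (f q)" if q: "1 < q" for q
  proof (rule Bochner_Integration.integrable_bound[OF g_int meas[OF q]])
    show "AE u in lborel. norm (f q u) \<le> norm (g q u)"
      using AE_bound[OF q] by eventually_elim (use f_nonneg in auto)
  qed
  have norm_eq: "Lp_norm (real p) (\<lambda>u. Q q u - Phi_inv u) ^ p = (LBINT u. f q u)" if "1 < q" for q
  proof -
    have nn: "0 \<le> (LBINT u. f q u)" using f_nonneg by (simp add: integral_nonneg)
    have "Lp_norm (real p) (\<lambda>u. Q q u - Phi_inv u) ^ p = ((LBINT u. f q u) powr (1 / real p)) ^ p"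
      by (simp add: Lp_norm_def set_lebesgue_integral_def f_def)
    \<comment> \<open>A zero integral is split off because \<open>powr_realpow\<close> needs a
      positive base.\<close>
    also have "\<dots> = ((LBINT u. f q u) powr (1 / real p)) powr real p"
      using p nn by (cases "(LBINT u. f q u) = 0") (auto simp: powr_realpow)
    also have "\<dots> = (LBINT u. f q u)" using p nn by (simp add: powr_powr)
    finally show ?thesis .
  qed
  define B where "B = 2 * M * (LBINT w. tail_weight w)"
  have "(LBINT u. f q u) \<le> B * (2 powr (- real q) * real q powr (- real p / 2))" if q: "1 < q" for q
  proof -
    have "(LBINT u. f q u) \<le> (LBINT u. g q u)"
      by (rule integral_mono_AE[OF f_int[OF q] g_int AE_bound[OF q]])
    also have "\<dots> = M * real q powr (- real p / 2) * (2 * (LBINT w. tail_weight w) / 2 ^ q)"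
      unfolding g_def W_def by (simp only: integral_mult_right_zero tail_weight_affine(2))
    also have "\<dots> = B * (2 powr (- real q) * real q powr (- real p / 2))"
      by (simp add: B_def powr_minus powr_realpow divide_simps)
    finally show ?thesis .
  qed
  then have "norm (Lp_norm (real p) (\<lambda>u. Q q u - Phi_inv u) ^ p)
      \<le> B * norm (2 powr (- real q) * real q powr (- real p / 2))" if "1 < q" for q
    using that f_nonneg by (simp add: norm_eq integral_nonneg)
  then have "(\<lambda>q. Lp_norm (real p) (\<lambda>u. Q q u - Phi_inv u) ^ p)
      \<in> O(\<lambda>q. 2 powr (- real q) * real q powr (- real p / 2))"
    by (intro bigoI[of _ B] eventually_mono[OF eventually_gt_at_top[of 1]])
  moreover have "Lp_finite (real p) (\<lambda>u. Q q u - Phi_inv u)" if "1 < q" for q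
    using f_int[OF that] by (simp add: Lp_finite_def set_integrable_def f_def[abs_def])
  ultimately show ?thesis by blast
qed

end
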